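(* Let $D$ be a digraph and let $k\geq \Delta_{\max}(D)+1$ be an integer. If $\alpha$ is a $k$-frozen dicolouring of $D$, then $D$ is bidirected. Consequently, for a connected digraph $D$ with $\Delta_{\max}(D)\geq 3$ and an integer $k\geq \Delta_{\max}(D)+1$, $D$ admits a $k$-frozen dicolouring if and only if $D=\overleftrightarrow{G}$ for some connected undirected graph $G$ with $\Delta(G)\geq 3$ and $k\geq\Delta(G)+1$ that admits a $k$-frozen colouring.
   Context: Digraphs are finite, without loops or parallel arcs; two arcs in opposite directions between the same two vertices are allowed. A digraph is connected if its underlying undirected graph is connected. For a vertex $v$, $d^+(v)$ and $d^-(v)$ denote its out-degree and in-degree, and $\Delta_{\max}(D)=\max_{v\in V(D)} \max\{d^+(v),d^-(v)\}$; $\Delta(G)$ is the maximum degree of an undirected graph $G$. A $k$-dicolouring of $D$ is a function $c:V(D)\to\{1,\dots,k\}$ such that for each $i$ the set $c^{-1}(i)$ induces a subdigraph with no directed cycle (a pair of opposite arcs between two vertices is a directed cycle of length 2). A $k$-dicolouring is $k$-frozen if no other $k$-dicolouring of $D$ differs from it on the colour of exactly one vertex. A $k$-colouring of an undirected graph $G$ is a proper colouring with colours $\{1,\dots,k\}$; it is $k$-frozen if no other $k$-colouring of $G$ differs from it on the colour of exactly one vertex. For an undirected (simple) graph $G$, $\overleftrightarrow{G}$ is the digraph obtained by replacing every edge by two arcs in opposite directions; a digraph is bidirected if it is of the form $\overleftrightarrow{G}$. *)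

theory Defs
  imports "Graph_Theory.Digraph_Component"
begin

text \<open>
  Finite digraphs without loops or parallel arcs are the locale \<open>pair_digraph\<close>. The library's
  \<open>connected\<close> is connectedness of the underlying undirected graph; it excludes the null digraph.
\<close>

text \<open>The inserted 0 only matters for the null digraph, whose maximum degree is 0.\<close>

definition max_degree :: "'a pair_pre_digraph \<Rightarrow> nat" where
  "max_degree D =
     Max (insert 0 ((\<lambda>v. max (out_degree (with_proj D) v) (in_degree (with_proj D) v)) ` pverts D))"

text \<open>
  Colourings are total functions of which only the values on the vertices matter. The library's
  \<open>cycle\<close> is a closed directed walk without repeated vertices, traversing at least one arc;
  two opposite arcs form one.
\<close>

definition dicolouring :: "'a pair_pre_digraph \<Rightarrow> nat \<Rightarrow> ('a \<Rightarrow> nat) \<Rightarrow> bool" where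
  "dicolouring D k c \<longleftrightarrow>
     c ` pverts D \<subseteq> {1..k} \<and>
     (\<forall>i\<in>{1..k}. \<nexists>p. pre_digraph.cycle (with_proj D \<restriction> {v \<in> pverts D. c v = i}) p)"

definition frozen_dicolouring :: "'a pair_pre_digraph \<Rightarrow> nat \<Rightarrow> ('a \<Rightarrow> nat) \<Rightarrow> bool" where
  "frozen_dicolouring D k c \<longleftrightarrow>
     dicolouring D k c \<and>
     (\<nexists>c'. dicolouring D k c' \<and> (\<exists>!v. v \<in> pverts D \<and> c' v \<noteq> c v))"

record 'a ugraph =
  uverts :: "'a set"
  uedges :: "'a set set"

definition simple_ugraph :: "'a ugraph \<Rightarrow> bool" where
  "simple_ugraph G \<longleftrightarrow>
     finite (uverts G) \<and> (\<forall>e\<in>uedges G. e \<subseteq> uverts G \<and> card e = 2)"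

definition uconnected :: "'a ugraph \<Rightarrow> bool" where
  "uconnected G \<longleftrightarrow>
     uverts G \<noteq> {} \<and>
     (\<forall>u\<in>uverts G. \<forall>v\<in>uverts G. (u, v) \<in> {(x, y). {x, y} \<in> uedges G}\<^sup>*)"

definition udegree :: "'a ugraph \<Rightarrow> 'a \<Rightarrow> nat" where
  "udegree G v = card {e \<in> uedges G. v \<in> e}"

definition max_udegree :: "'a ugraph \<Rightarrow> nat" where
  "max_udegree G = Max (insert 0 (udegree G ` uverts G))"

definition colouring :: "'a ugraph \<Rightarrow> nat \<Rightarrow> ('a \<Rightarrow> nat) \<Rightarrow> bool" where
  "colouring G k c \<longleftrightarrow>
     c ` uverts G \<subseteq> {1..k} \<and> (\<forall>u v. {u, v} \<in> uedges G \<longrightarrow> c u \<noteq> c v)"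

definition frozen_colouring :: "'a ugraph \<Rightarrow> nat \<Rightarrow> ('a \<Rightarrow> nat) \<Rightarrow> bool" where
  "frozen_colouring G k c \<longleftrightarrow>
     colouring G k c \<and>
     (\<nexists>c'. colouring G k c' \<and> (\<exists>!v. v \<in> uverts G \<and> c' v \<noteq> c v))"

definition bidirect :: "'a ugraph \<Rightarrow> 'a pair_pre_digraph" where
  "bidirect G = \<lparr>pverts = uverts G, parcs = {(u, v). {u, v} \<in> uedges G}\<rparr>"

definition bidirected :: "'a pair_pre_digraph \<Rightarrow> bool" where
  "bidirected D \<longleftrightarrow> (\<exists>G. simple_ugraph G \<and> D = bidirect G)"

end

theory Submission
  imports Defs
begin

text \<open>
  A colouring is a dicolouring exactly when the relation of its monochromatic arcs is acyclic, so
  everything below is about that relation.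

  Let \<open>\<alpha>\<close> be a frozen dicolouring with \<open>k \<ge> \<Delta>\<^sub>m\<^sub>a\<^sub>x + 1\<close> colours. Recolouring a vertex \<open>v\<close> with
  another colour \<open>i\<close> must create a directed cycle through \<open>v\<close>, so \<open>v\<close> has an out-neighbour of
  colour \<open>i\<close>. There are \<open>k - 1\<close> such colours and at most \<open>k - 1\<close> out-neighbours, so \<open>\<alpha>\<close> maps the
  out-neighbours of \<open>v\<close> bijectively to the colours other than that of \<open>v\<close>
  (\<open>frozen_out_neighbours\<close>). In particular no arc is monochromatic. If now \<open>v\<close> has an arc to \<open>u\<close>
  and takes the colour of \<open>u\<close>, then every monochromatic arc is incident with \<open>v\<close>, and the only one
  that leaves \<open>v\<close> goes to \<open>u\<close>; a directed cycle can only be formed with the arc from \<open>u\<close> to \<open>v\<close>.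
  Hence every arc has its opposite (\<open>frozen_imp_sym\<close>).

  The equivalence follows because the frozen dicolourings of a bidirected digraph are the frozen
  colourings of its graph, in which opposite arcs count as one edge; the two have the same maximum
  degree, and connectedness of the digraph carries over to the graph.
\<close>

section \<open>Monochromatic arcs\<close>

definition mono_arcs :: "('a \<times> 'a) set \<Rightarrow> ('a \<Rightarrow> 'b) \<Rightarrow> ('a \<times> 'a) set" where
  "mono_arcs A c = {(u, v) \<in> A. c u = c v}"

lemma (in wf_digraph) no_cycle_iff_acyclic: "(\<nexists>p. cycle p) \<longleftrightarrow> acyclic (arcs_ends G)"
proof -
  have "(\<exists>p. cycle p) \<longleftrightarrow> (\<exists>p. closed_w p)"
    using closed_w_imp_cycle by (auto simp: cycle_altdef)
  also have "\<dots> \<longleftrightarrow> (\<exists>u. u \<rightarrow>\<^sup>+ u)"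
    by (auto simp: closed_w_def reachable1_awalk)
  finally show ?thesis
    by (auto simp: acyclic_def)
qed

text \<open>A directed path of monochromatic arcs never leaves the colour class in which it starts.\<close>

lemma trancl_mono_arcs:
  assumes "(x, y) \<in> (mono_arcs A c)\<^sup>+"
  shows "c y = c x \<and> (x, y) \<in> {(u, v) \<in> A. c u = c x \<and> c v = c x}\<^sup>+"
  using assms
proof induction
  case (base y)
  then show ?case by (auto simp: mono_arcs_def)
next
  case (step y z)
  then have "(y, z) \<in> {(u, v) \<in> A. c u = c x \<and> c v = c x}"
    by (auto simp: mono_arcs_def)
  with step show ?case by (auto intro: trancl_into_trancl)
qed

lemma acyclic_mono_arcs_iff:
  "acyclic (mono_arcs A c) \<longleftrightarrow> (\<forall>i. acyclic {(u, v) \<in> A. c u = i \<and> c v = i})"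
proof
  assume "acyclic (mono_arcs A c)"
  then show "\<forall>i. acyclic {(u, v) \<in> A. c u = i \<and> c v = i}"
    by (auto simp: mono_arcs_def elim: acyclic_subset)
next
  assume classes: "\<forall>i. acyclic {(u, v) \<in> A. c u = i \<and> c v = i}"
  have "(x, x) \<notin> (mono_arcs A c)\<^sup>+" for x
    using trancl_mono_arcs[of x x A c] spec[OF classes, of "c x"] unfolding acyclic_def by blast
  then show "acyclic (mono_arcs A c)"
    by (simp add: acyclic_def)
qed

lemma dicolouring_iff_acyclic:
  assumes "pair_wf_digraph D"
  shows "dicolouring D k c \<longleftrightarrow> c ` pverts D \<subseteq> {1..k} \<and> acyclic (mono_arcs (parcs D) c)"
proof -
  interpret pair_wf_digraph D by fact
  let ?C = "\<lambda>i. {(u, v) \<in> parcs D. c u = i \<and> c v = i}"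
  have ends: "arcs_ends (with_proj D \<restriction> {v \<in> pverts D. c v = i}) = ?C i" for i
    by (auto simp: arcs_ends_conv image_iff dest: in_arcsD1 in_arcsD2)
  have wf: "wf_digraph (with_proj D \<restriction> {v \<in> pverts D. c v = i})" for i
    by (rule wellformed_induce_subgraph)
  have class_iff: "(\<nexists>p. pre_digraph.cycle (with_proj D \<restriction> {v \<in> pverts D. c v = i}) p)
      \<longleftrightarrow> acyclic (?C i)" for i
    using wf_digraph.no_cycle_iff_acyclic[OF wf] by (simp only: ends)
  have "acyclic (?C i)" if "c ` pverts D \<subseteq> {1..k}" "i \<notin> {1..k}" for i
  proof -
    have "?C i = {}" using that by (blast dest: in_arcsD1)
    then show ?thesis unfolding acyclic_def by (simp only: trancl_empty) simp
  qed
  then show ?thesis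
    unfolding dicolouring_def class_iff acyclic_mono_arcs_iff by blast
qed

text \<open>
  A directed cycle must leave each of its vertices, so arcs into a vertex without out-going arcs are
  irrelevant for acyclicity.
\<close>

lemma acyclic_into_sink:
  assumes "acyclic r" and "v \<notin> Domain r'" and "\<And>x y. (x, y) \<in> r' \<Longrightarrow> y \<noteq> v \<Longrightarrow> (x, y) \<in> r"
  shows "acyclic r'"
proof -
  have path: "y \<noteq> v \<longrightarrow> (x, y) \<in> r\<^sup>+" if "(x, y) \<in> r'\<^sup>+" for x y
    using that
  proof induction
    case (base y)
    then show ?case using assms(3) by auto
  next
    case (step y z)
    then have "y \<noteq> v" using assms(2) by blast
    with step show ?case using assms(3) by (meson trancl.trancl_into_trancl)
  qed
  show ?thesis
    unfolding acyclic_def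
  proof (intro allI notI)
    fix x assume "(x, x) \<in> r'\<^sup>+"
    moreover from this have "x \<noteq> v" using assms(2) by (metis tranclD DomainI)
    ultimately show False using path assms(1) by (auto simp: acyclic_def)
  qed
qed

section \<open>Frozen dicolourings\<close>

lemma frozen_recolour_not_acyclic:
  assumes "pair_wf_digraph D" and "frozen_dicolouring D k c"
    and "v \<in> pverts D" and "i \<in> {1..k}" and "i \<noteq> c v"
  shows "\<not> acyclic (mono_arcs (parcs D) (c(v := i)))"
proof
  assume "acyclic (mono_arcs (parcs D) (c(v := i)))"
  moreover have "(c(v := i)) ` pverts D \<subseteq> {1..k}"
    using assms by (auto simp: frozen_dicolouring_def dicolouring_def)
  ultimately have "dicolouring D k (c(v := i))"
    using assms(1) by (simp add: dicolouring_iff_acyclic)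
  moreover have "\<exists>!w. w \<in> pverts D \<and> (c(v := i)) w \<noteq> c w"
    using assms by (intro ex1I[of _ v]) (auto split: if_splits)
  ultimately show False
    using assms(2) unfolding frozen_dicolouring_def by blast
qed

text \<open>
  Otherwise \<open>v\<close>, recoloured with \<open>i\<close>, would be a sink of the monochromatic arcs and could not close
  a directed cycle.
\<close>

lemma frozen_has_out_neighbour:
  assumes "pair_loopfree_digraph D" and "frozen_dicolouring D k c"
    and "v \<in> pverts D" and "i \<in> {1..k}" and "i \<noteq> c v"
  shows "\<exists>u. (v, u) \<in> parcs D \<and> c u = i"
proof (rule ccontr)
  interpret pair_loopfree_digraph D by fact
  have wf: "pair_wf_digraph D" by unfold_locales
  assume none: "\<not> ?thesis"
  have "acyclic (mono_arcs (parcs D) (c(v := i)))"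
  proof (rule acyclic_into_sink)
    show "acyclic (mono_arcs (parcs D) c)"
      using assms(2) wf by (simp add: frozen_dicolouring_def dicolouring_iff_acyclic)
    show sink: "v \<notin> Domain (mono_arcs (parcs D) (c(v := i)))"
      using none pair_no_loops[of "(v, v)"] by (auto simp: mono_arcs_def split: if_splits)
    show "(x, y) \<in> mono_arcs (parcs D) c"
      if "(x, y) \<in> mono_arcs (parcs D) (c(v := i))" "y \<noteq> v" for x y
      using that sink by (auto simp: mono_arcs_def split: if_splits)
  qed
  then show False
    using frozen_recolour_not_acyclic[OF wf assms(2-)] by blast
qed

lemma bij_betw_if_covers:
  assumes "finite N" and "card N \<le> card C" and "C \<subseteq> f ` N"
  shows "bij_betw f N C"
proof -
  have "card C \<le> card (f ` N)" "card (f ` N) \<le> card N"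
    using assms by (simp_all add: card_mono card_image_le)
  then have "C = f ` N" "card (f ` N) = card N"
    using assms card_subset_eq[of "f ` N" C] by simp_all
  then show ?thesis
    using assms(1) by (simp add: bij_betw_def eq_card_imp_inj_on)
qed

lemma (in pair_fin_digraph) card_out_neighbours_le_max_degree:
  assumes "v \<in> pverts G"
  shows "finite {u. (v, u) \<in> parcs G}" and "card {u. (v, u) \<in> parcs G} \<le> max_degree G"
proof -
  have img: "{u. (v, u) \<in> parcs G} = snd ` out_arcs (with_proj G) v"
    by (force simp: out_arcs_def)
  have fin: "finite (out_arcs (with_proj G) v)" by (rule finite_out_arcs)
  from img fin show "finite {u. (v, u) \<in> parcs G}" by simp
  have "card {u. (v, u) \<in> parcs G} \<le> out_degree (with_proj G) v"
    unfolding img out_degree_def using fin by (rule card_image_le)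
  also have "\<dots> \<le> max (out_degree (with_proj G) v) (in_degree (with_proj G) v)" by simp
  also have "\<dots> \<le> max_degree G"
    unfolding max_degree_def using assms pair_finite_verts by (intro Max_ge) auto
  finally show "card {u. (v, u) \<in> parcs G} \<le> max_degree G" .
qed

text \<open>The pigeonhole principle is tight here: \<open>k - 1\<close> colours for at most \<open>k - 1\<close> out-neighbours.\<close>

lemma frozen_out_neighbours:
  assumes "pair_digraph D" and "frozen_dicolouring D k c" and "k \<ge> max_degree D + 1"
    and "v \<in> pverts D"
  shows "bij_betw c {u. (v, u) \<in> parcs D} ({1..k} - {c v})"
proof (rule bij_betw_if_covers)
  interpret pair_digraph D by fact
  show "finite {u. (v, u) \<in> parcs D}"
    using assms(4) by (rule card_out_neighbours_le_max_degree)
  have "c v \<in> {1..k}"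
    using assms(2,4) by (auto simp: frozen_dicolouring_def dicolouring_def)
  then have "card ({1..k} - {c v}) = k - 1" by simp
  then show "card {u. (v, u) \<in> parcs D} \<le> card ({1..k} - {c v})"
    using card_out_neighbours_le_max_degree(2)[OF assms(4)] assms(3) by simp
  have "pair_loopfree_digraph D" by unfold_locales
  then show "{1..k} - {c v} \<subseteq> c ` {u. (v, u) \<in> parcs D}"
    using frozen_has_out_neighbour[OF _ assms(2,4)] by force
qed

lemma frozen_imp_sym:
  assumes "pair_digraph D" and "frozen_dicolouring D k c" and "k \<ge> max_degree D + 1"
    and "(v, u) \<in> parcs D"
  shows "(u, v) \<in> parcs D"
proof (rule ccontr)
  interpret pair_digraph D by fact
  have wf: "pair_wf_digraph D" by unfold_locales
  assume no_opposite: "(u, v) \<notin> parcs D"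
  have bij: "bij_betw c {y. (x, y) \<in> parcs D} ({1..k} - {c x})" if "x \<in> pverts D" for x
    using assms(1-3) that by (rule frozen_out_neighbours)
  have proper: "c x \<noteq> c y" if "(x, y) \<in> parcs D" for x y
    using bij_betw_apply[OF bij[OF in_arcsD1[OF that]], of y] that by auto
  have v: "v \<in> pverts D" using assms(4) by (rule in_arcsD1)
  have unique: "y = u" if "(v, y) \<in> parcs D" "c y = c u" for y
    using bij[OF v] that assms(4) by (auto simp: bij_betw_def dest: inj_onD)
  \<comment> \<open>Without the opposite arc, \<open>u\<close> is a sink of the recoloured monochromatic arcs: they only go
    from other vertices to \<open>v\<close> and from \<open>v\<close> to \<open>u\<close>.\<close>
  define level :: "'a \<Rightarrow> nat" where "level x = (if x = u then 2 else if x = v then 1 else 0)" for x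
  have "mono_arcs (parcs D) (c(v := c u)) \<subseteq> measure level"
  proof (rule subrelI)
    fix x y assume "(x, y) \<in> mono_arcs (parcs D) (c(v := c u))"
    then have xy: "(x, y) \<in> parcs D" and "(c(v := c u)) x = (c(v := c u)) y"
      by (simp_all add: mono_arcs_def)
    with proper[OF xy] consider "x = v" "c y = c u" | "x \<noteq> v" "y = v"
      by (auto split: if_splits)
    then show "(x, y) \<in> measure level"
    proof cases
      case 1
      then have "y = u" using unique xy by blast
      with 1 show ?thesis using proper[OF xy] by (auto simp: level_def)
    next
      case 2
      then have "x \<noteq> u" using no_opposite xy by blast
      with 2 show ?thesis using proper[OF assms(4)] by (auto simp: level_def)
    qed
  qed
  then have "acyclic (mono_arcs (parcs D) (c(v := c u)))"
    by (meson wf_acyclic wf_measure wf_subset)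
  moreover have "c u \<in> {1..k}"
    using assms(2) in_arcsD2[OF assms(4)] by (auto simp: frozen_dicolouring_def dicolouring_def)
  ultimately show False
    using frozen_recolour_not_acyclic[OF wf assms(2) v] proper[OF assms(4)] by auto
qed

section \<open>Graphs and their bidirected digraphs\<close>

lemma bidirect_simps [simp]:
  "pverts (bidirect G) = uverts G"
  "(u, v) \<in> parcs (bidirect G) \<longleftrightarrow> {u, v} \<in> uedges G"
  by (simp_all add: bidirect_def)

lemma pair_wf_digraph_bidirect:
  assumes "simple_ugraph G"
  shows "pair_wf_digraph (bidirect G)"
  using assms by unfold_locales (fastforce simp: simple_ugraph_def)+

lemma sym_imp_bidirected:
  assumes "pair_digraph D" and "\<And>u v. (u, v) \<in> parcs D \<Longrightarrow> (v, u) \<in> parcs D"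
  shows "bidirected D"
proof -
  interpret pair_digraph D by fact
  define G where "G = \<lparr>uverts = pverts D, uedges = {{u, v} |u v. (u, v) \<in> parcs D}\<rparr>"
  have "simple_ugraph G"
    using pair_finite_verts pair_no_loops
    by (fastforce simp: simple_ugraph_def G_def card_2_iff dest: in_arcsD1 in_arcsD2)
  moreover have "parcs D = parcs (bidirect G)"
    using assms(2) by (auto simp: bidirect_def G_def doubleton_eq_iff)
  then have "D = bidirect G"
    by (simp add: pair_pre_digraph.equality G_def)
  ultimately show ?thesis
    unfolding bidirected_def by blast
qed

text \<open>An edge with equal end colours would be a monochromatic directed cycle of length 2.\<close>

lemma dicolouring_bidirect_iff:
  assumes "simple_ugraph G"
  shows "dicolouring (bidirect G) k c \<longleftrightarrow> colouring G k c"
proof -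
  let ?M = "mono_arcs (parcs (bidirect G)) c"
  have "acyclic ?M \<longleftrightarrow> ?M = {}"
  proof
    assume acyc: "acyclic ?M"
    have "(u, v) \<notin> ?M" for u v
    proof
      assume "(u, v) \<in> ?M"
      moreover from this have "(v, u) \<in> ?M" by (auto simp: mono_arcs_def insert_commute)
      ultimately have "(u, u) \<in> ?M\<^sup>+" by auto
      with acyc show False by (auto simp: acyclic_def)
    qed
    then show "?M = {}" by auto
  qed (simp add: acyclic_def)
  also have "\<dots> \<longleftrightarrow> (\<forall>u v. {u, v} \<in> uedges G \<longrightarrow> c u \<noteq> c v)"
    by (auto simp: mono_arcs_def)
  finally show ?thesis
    by (simp add: dicolouring_iff_acyclic[OF pair_wf_digraph_bidirect[OF assms]] colouring_def)
qed

lemma frozen_dicolouring_bidirect_iff: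
  assumes "simple_ugraph G"
  shows "frozen_dicolouring (bidirect G) k c \<longleftrightarrow> frozen_colouring G k c"
  by (simp add: frozen_dicolouring_def frozen_colouring_def dicolouring_bidirect_iff[OF assms])

lemma degree_bidirect:
  assumes "simple_ugraph G"
  shows "out_degree (with_proj (bidirect G)) v = udegree G v"
    and "in_degree (with_proj (bidirect G)) v = udegree G v"
proof -
  have ends: "\<exists>u. e = {v, u}" if "e \<in> uedges G" "v \<in> e" for e
    using that assms by (fastforce simp: simple_ugraph_def card_2_iff)
  let ?N = "{u. {v, u} \<in> uedges G}"
  have "bij_betw (\<lambda>u. {v, u}) ?N {e \<in> uedges G. v \<in> e}"
    using ends by (auto simp: bij_betw_def inj_on_def doubleton_eq_iff)
  then have "card ?N = udegree G v"
    unfolding udegree_def by (rule bij_betw_same_card)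
  moreover have "bij_betw (Pair v) ?N (out_arcs (with_proj (bidirect G)) v)"
    by (auto simp: bij_betw_def inj_on_def out_arcs_def)
  then have "card ?N = out_degree (with_proj (bidirect G)) v"
    unfolding out_degree_def by (rule bij_betw_same_card)
  moreover have "bij_betw (\<lambda>u. (u, v)) ?N (in_arcs (with_proj (bidirect G)) v)"
    by (auto simp: bij_betw_def inj_on_def in_arcs_def insert_commute)
  then have "card ?N = in_degree (with_proj (bidirect G)) v"
    unfolding in_degree_def by (rule bij_betw_same_card)
  ultimately show "out_degree (with_proj (bidirect G)) v = udegree G v"
    and "in_degree (with_proj (bidirect G)) v = udegree G v"
    by simp_all
qed

lemma max_degree_bidirect: "simple_ugraph G \<Longrightarrow> max_degree (bidirect G) = max_udegree G"
  by (simp add: max_degree_def max_udegree_def degree_bidirect)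

lemma connected_bidirect_imp_uconnected:
  assumes "Digraph_Component.connected (with_proj (bidirect G))"
  shows "uconnected G"
proof -
  let ?S = "mk_symmetric (with_proj (bidirect G))"
  have "parcs ?S = {(x, y). {x, y} \<in> uedges G}"
    by (fastforce simp: mk_symmetric_def insert_commute)
  moreover have "pverts ?S = uverts G"
    by (simp add: mk_symmetric_def)
  ultimately show ?thesis
    using assms reachable_rtranclI[of "with_proj ?S"]
    by (auto simp: Digraph_Component.connected_def strongly_connected_def uconnected_def)
qed

theorem mainTheorem8:
  fixes D :: "'a pair_pre_digraph" and k :: nat
  assumes "pair_digraph D"
    and "k \<ge> max_degree D + 1"
  shows "(\<forall>\<alpha>. frozen_dicolouring D k \<alpha> \<longrightarrow> bidirected D) \<and>
    (Digraph_Component.connected (with_proj D) \<and> max_degree D \<ge> 3 \<longrightarrow>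
      ((\<exists>\<alpha>. frozen_dicolouring D k \<alpha>) \<longleftrightarrow>
       (\<exists>G. simple_ugraph G \<and> uconnected G \<and> max_udegree G \<ge> 3 \<and> k \<ge> max_udegree G + 1 \<and>
            D = bidirect G \<and> (\<exists>c. frozen_colouring G k c))))"
proof (intro conjI impI allI)
  show bidirected: "bidirected D" if "frozen_dicolouring D k \<alpha>" for \<alpha>
    using assms(1) frozen_imp_sym[OF assms(1) that assms(2)] by (rule sym_imp_bidirected)
  assume D: "Digraph_Component.connected (with_proj D) \<and> max_degree D \<ge> 3"
  show "(\<exists>\<alpha>. frozen_dicolouring D k \<alpha>) \<longleftrightarrow>
       (\<exists>G. simple_ugraph G \<and> uconnected G \<and> max_udegree G \<ge> 3 \<and> k \<ge> max_udegree G + 1 \<and>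
            D = bidirect G \<and> (\<exists>c. frozen_colouring G k c))"
  proof
    assume "\<exists>\<alpha>. frozen_dicolouring D k \<alpha>"
    then obtain \<alpha> where frozen: "frozen_dicolouring D k \<alpha>" ..
    then obtain G where G: "simple_ugraph G" "D = bidirect G"
      using bidirected unfolding bidirected_def by blast
    moreover have "uconnected G"
      using D G(2) connected_bidirect_imp_uconnected by blast
    moreover have "max_udegree G = max_degree D"
      using G by (simp add: max_degree_bidirect)
    moreover have "frozen_colouring G k \<alpha>"
      using frozen G by (simp add: frozen_dicolouring_bidirect_iff)
    ultimately show "\<exists>G. simple_ugraph G \<and> uconnected G \<and> max_udegree G \<ge> 3 \<and>
        k \<ge> max_udegree G + 1 \<and> D = bidirect G \<and> (\<exists>c. frozen_colouring G k c)"
      using D assms(2) by auto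
  qed (auto simp: frozen_dicolouring_bidirect_iff)
qed

end
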